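(* Let $\mathbf{k}$ be a unitary commutative ring and $\Omega$ a nonempty set. The quadruple $(H_{LR}(\Omega),\ast,|,\vee_\Omega)$, with $\vee_\Omega=\{\vee_\alpha\mid\alpha\in\Omega\}$, is the free $\vee_\Omega$-algebra on the empty set, that is, the initial object in the category of $\vee_\Omega$-algebras. More precisely, it is a $\vee_\Omega$-algebra, and for any $\vee_\Omega$-algebra $A=(A,\ast_A,1_A,\vee_{A,\Omega})$ there exists a unique $\vee_\Omega$-algebra morphism $\bar\phi:H_{LR}(\Omega)\to A$.
   Context: All modules, algebras, linear maps and tensor products are over $\mathbf{k}$; algebras are associative and unitary but not necessarily commutative, and algebra homomorphisms preserve the unit. Decorated trees. For $n\ge 0$, $Y_n(\Omega)$ is the set of planar binary rooted trees with $n$ interior vertices (each interior vertex has exactly a left and a right child), each interior vertex being decorated by an element of $\Omega$; leaves are not decorated. $Y_0(\Omega)=\{|\}$, where $|$ is the unique tree with one leaf and no interior vertex. $Y_\infty(\Omega)=\bigsqcup_{n\ge0}Y_n(\Omega)$ and $H_{LR}(\Omega)=\mathbf{k}Y_\infty(\Omega)$ is the free $\mathbf{k}$-module on it. For $\alpha\in\Omega$ and trees $T_1,T_2$, $T_1\vee_\alpha T_2$ is the tree whose root vertex is decorated by $\alpha$, with left subtree $T_1$ and right subtree $T_2$; $\vee_\alpha$ is extended to a linear map $H_{LR}(\Omega)\otimes H_{LR}(\Omega)\to H_{LR}(\Omega)$. Every tree $T\neq|$ is uniquely $T=T^l\vee_\alpha T^r$. Product: $\ast$ is the bilinear product on $H_{LR}(\Omega)$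 defined recursively by $|\ast T=T\ast|=T$ and, for $T=T^l\vee_\alpha T^r$, $T'=T'^l\vee_\beta T'^r$, $T\ast T'=T^l\vee_\alpha(T^r\ast T')+(T\ast T'^l)\vee_\beta T'^r$. A $\vee_\Omega$-algebra $(A,\ast_A,1_A,\vee_{A,\Omega})$ is an algebra $(A,\ast_A,1_A)$ with a set of binary operations (linear maps) $\vee_{A,\Omega}=\{\vee_{A,\alpha}:A\otimes A\to A\mid\alpha\in\Omega\}$ such that, for all $\alpha,\alpha'\in\Omega$ and $a=a_1\vee_{A,\alpha}a_2$, $a'=a_1'\vee_{A,\alpha'}a_2'$ (with $a_1,a_2,a_1',a_2'\in A$), $$a\ast_A a'=a_1\vee_{A,\alpha}(a_2\ast_A a')+(a\ast_A a_1')\vee_{A,\alpha'}a_2'.$$ A $\vee_\Omega$-algebra morphism $\phi:A\to A'$ is an algebra homomorphism with $\phi\circ\vee_{A,\alpha}=\vee_{A',\alpha}\circ(\phi\otimes\phi)$ for every $\alpha\in\Omega$. A free $\vee_\Omega$-algebra on a set $X$ is a $\vee_\Omega$-algebra $A$ with a set map $j:X\to A$ such that for every $\vee_\Omega$-algebra $A'$ and set map $\phi:X\to A'$ there is a unique $\vee_\Omega$-algebra morphism $\bar\phi:A\to A'$ with $\bar\phi\circ j=\phi$. *)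

theory Defs
  imports "HOL-Algebra.Module" "HOL-Library.Tree"
begin

section \<open>Algebras with a family of grafting operations\<close>

text \<open>
  The locale \<^locale>\<open>algebra\<close> requires a commutative multiplication, so it cannot be reused here.
  Carriers are explicit throughout; hence the zero ring is allowed both as
  base ring and as algebra.
\<close>

locale assoc_algebra = module R A + ring A
  for R :: "('k, 'r) ring_scheme" (structure) and A :: "('k, 'a, 'm) module_scheme" (structure) +
  assumes smult_mult_left:
      "\<lbrakk>c \<in> carrier R; x \<in> carrier A; y \<in> carrier A\<rbrakk>
        \<Longrightarrow> (c \<odot>\<^bsub>A\<^esub> x) \<otimes>\<^bsub>A\<^esub> y = c \<odot>\<^bsub>A\<^esub> (x \<otimes>\<^bsub>A\<^esub> y)"
    and smult_mult_right:
      "\<lbrakk>c \<in> carrier R; x \<in> carrier A; y \<in> carrier A\<rbrakk>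
        \<Longrightarrow> x \<otimes>\<^bsub>A\<^esub> (c \<odot>\<^bsub>A\<^esub> y) = c \<odot>\<^bsub>A\<^esub> (x \<otimes>\<^bsub>A\<^esub> y)"

record ('k, 'a, 'o) vee_alg = "('k, 'a) module" +
  vee :: "'o \<Rightarrow> 'a \<Rightarrow> 'a \<Rightarrow> 'a"

text \<open>
  Linear maps on \<open>A \<otimes> A\<close> are given as bilinear maps. The operation \<^const>\<open>vee\<close> is constrained
  only for indices in \<open>\<Omega>\<close>.
\<close>

locale vee_algebra = assoc_algebra R A
  for R :: "('k, 'r) ring_scheme" (structure) and \<Omega> :: "'o set"
    and A :: "('k, 'a, 'o, 'm) vee_alg_scheme" (structure) +
  assumes vee_closed:
      "\<lbrakk>\<alpha> \<in> \<Omega>; x \<in> carrier A; y \<in> carrier A\<rbrakk> \<Longrightarrow> vee A \<alpha> x y \<in> carrier A"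
    and vee_add_left:
      "\<lbrakk>\<alpha> \<in> \<Omega>; x \<in> carrier A; x' \<in> carrier A; y \<in> carrier A\<rbrakk>
        \<Longrightarrow> vee A \<alpha> (x \<oplus>\<^bsub>A\<^esub> x') y = vee A \<alpha> x y \<oplus>\<^bsub>A\<^esub> vee A \<alpha> x' y"
    and vee_add_right:
      "\<lbrakk>\<alpha> \<in> \<Omega>; x \<in> carrier A; y \<in> carrier A; y' \<in> carrier A\<rbrakk>
        \<Longrightarrow> vee A \<alpha> x (y \<oplus>\<^bsub>A\<^esub> y') = vee A \<alpha> x y \<oplus>\<^bsub>A\<^esub> vee A \<alpha> x y'"
    and vee_smult_left:
      "\<lbrakk>\<alpha> \<in> \<Omega>; c \<in> carrier R; x \<in> carrier A; y \<in> carrier A\<rbrakk>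
        \<Longrightarrow> vee A \<alpha> (c \<odot>\<^bsub>A\<^esub> x) y = c \<odot>\<^bsub>A\<^esub> vee A \<alpha> x y"
    and vee_smult_right:
      "\<lbrakk>\<alpha> \<in> \<Omega>; c \<in> carrier R; x \<in> carrier A; y \<in> carrier A\<rbrakk>
        \<Longrightarrow> vee A \<alpha> x (c \<odot>\<^bsub>A\<^esub> y) = c \<odot>\<^bsub>A\<^esub> vee A \<alpha> x y"
    and vee_mult:
      "\<lbrakk>\<alpha> \<in> \<Omega>; \<alpha>' \<in> \<Omega>; a\<^sub>1 \<in> carrier A; a\<^sub>2 \<in> carrier A; a\<^sub>1' \<in> carrier A; a\<^sub>2' \<in> carrier A\<rbrakk>
        \<Longrightarrow> vee A \<alpha> a\<^sub>1 a\<^sub>2 \<otimes>\<^bsub>A\<^esub> vee A \<alpha>' a\<^sub>1' a\<^sub>2' =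
          vee A \<alpha> a\<^sub>1 (a\<^sub>2 \<otimes>\<^bsub>A\<^esub> vee A \<alpha>' a\<^sub>1' a\<^sub>2') \<oplus>\<^bsub>A\<^esub> vee A \<alpha>' (vee A \<alpha> a\<^sub>1 a\<^sub>2 \<otimes>\<^bsub>A\<^esub> a\<^sub>1') a\<^sub>2'"

definition vee_hom ::
  "('k, 'r) ring_scheme \<Rightarrow> 'o set \<Rightarrow> ('k, 'a, 'o, 'm) vee_alg_scheme \<Rightarrow>
    ('k, 'b, 'o, 'n) vee_alg_scheme \<Rightarrow> ('a \<Rightarrow> 'b) set"
  where "vee_hom R \<Omega> A B = {\<phi> \<in> ring_hom A B.
    (\<forall>c \<in> carrier R. \<forall>x \<in> carrier A. \<phi> (c \<odot>\<^bsub>A\<^esub> x) = c \<odot>\<^bsub>B\<^esub> \<phi> x) \<and>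
    (\<forall>\<alpha> \<in> \<Omega>. \<forall>x \<in> carrier A. \<forall>y \<in> carrier A. \<phi> (vee A \<alpha> x y) = vee B \<alpha> (\<phi> x) (\<phi> y))}"

text \<open>
  HOL functions are total, so uniqueness of a morphism is uniqueness among functions that are
  \<^const>\<open>extensional\<close> on the carrier. The test algebras \<open>B\<close> have elements in an arbitrary type \<open>'b\<close>;
  HOL cannot quantify over \<open>'b\<close> inside a definition, so it is passed as an argument.
\<close>

definition free_vee_algebra ::
  "'b itself \<Rightarrow> ('k, 'r) ring_scheme \<Rightarrow> 'o set \<Rightarrow> 'x set \<Rightarrow> ('x \<Rightarrow> 'a) \<Rightarrow>
    ('k, 'a, 'o, 'm) vee_alg_scheme \<Rightarrow> bool"
  where "free_vee_algebra _ R \<Omega> S j A \<longleftrightarrow>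
    vee_algebra R \<Omega> A \<and> j \<in> S \<rightarrow> carrier A \<and>
    (\<forall>B :: ('k, 'b, 'o) vee_alg. \<forall>\<phi>. vee_algebra R \<Omega> B \<and> \<phi> \<in> S \<rightarrow> carrier B \<longrightarrow>
      (\<exists>!\<psi>. \<psi> \<in> vee_hom R \<Omega> A B \<and> \<psi> \<in> extensional (carrier A) \<and> (\<forall>x \<in> S. \<psi> (j x) = \<phi> x)))"

section \<open>Decorated planar binary trees and the algebra they span\<close>

text \<open>
  \<^const>\<open>Leaf\<close> is the tree \<open>|\<close>, and \<open>Node l \<alpha> r\<close> is the grafting of \<open>l\<close> and \<open>r\<close> onto a root decorated by
  \<open>\<alpha>\<close>; \<^const>\<open>size\<close> counts interior vertices.
\<close>

definition Y :: "nat \<Rightarrow> 'o set \<Rightarrow> 'o tree set"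
  where "Y n \<Omega> = {T. size T = n \<and> set_tree T \<subseteq> \<Omega>}"

definition Y_inf :: "'o set \<Rightarrow> 'o tree set"
  where "Y_inf \<Omega> = (\<Union>n. Y n \<Omega>)"

text \<open>
  An element of the free module on the trees is its coefficient function. The next two functions
  give the basis vector of a tree and the bilinear extension of a map \<open>m\<close> prescribed on pairs of
  trees.
\<close>

definition basis_vec :: "('k, 'r) ring_scheme \<Rightarrow> 'o tree \<Rightarrow> 'o tree \<Rightarrow> 'k"
  where "basis_vec R T = (\<lambda>U. if U = T then \<one>\<^bsub>R\<^esub> else \<zero>\<^bsub>R\<^esub>)"

definition bilin_ext ::
  "('k, 'r) ring_scheme \<Rightarrow> ('o tree \<Rightarrow> 'o tree \<Rightarrow> 'o tree \<Rightarrow> 'k) \<Rightarrow>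
    ('o tree \<Rightarrow> 'k) \<Rightarrow> ('o tree \<Rightarrow> 'k) \<Rightarrow> 'o tree \<Rightarrow> 'k"
  where "bilin_ext R m f g = (\<lambda>U.
    finsum R (\<lambda>(T, T'). f T \<otimes>\<^bsub>R\<^esub> g T' \<otimes>\<^bsub>R\<^esub> m T T' U)
      ({T. f T \<noteq> \<zero>\<^bsub>R\<^esub>} \<times> {T'. g T' \<noteq> \<zero>\<^bsub>R\<^esub>}))"

definition graft ::
  "('k, 'r) ring_scheme \<Rightarrow> 'o \<Rightarrow> ('o tree \<Rightarrow> 'k) \<Rightarrow> ('o tree \<Rightarrow> 'k) \<Rightarrow> 'o tree \<Rightarrow> 'k"
  where "graft R \<alpha> = bilin_ext R (\<lambda>T T'. basis_vec R (Node T \<alpha> T'))"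

fun tree_prod :: "('k, 'r) ring_scheme \<Rightarrow> 'o tree \<Rightarrow> 'o tree \<Rightarrow> 'o tree \<Rightarrow> 'k" where
  "tree_prod R Leaf T = basis_vec R T"
| "tree_prod R T Leaf = basis_vec R T"
| "tree_prod R (Node l \<alpha> r) (Node l' \<beta> r') =
    (\<lambda>U. graft R \<alpha> (basis_vec R l) (tree_prod R r (Node l' \<beta> r')) U \<oplus>\<^bsub>R\<^esub>
         graft R \<beta> (tree_prod R (Node l \<alpha> r) l') (basis_vec R r') U)"

definition H_LR :: "('k, 'r) ring_scheme \<Rightarrow> 'o set \<Rightarrow> ('k, 'o tree \<Rightarrow> 'k, 'o) vee_alg"
  where "H_LR R \<Omega> = \<lparr>
    carrier = {f. (\<forall>T. f T \<in> carrier R) \<and> finite {T. f T \<noteq> \<zero>\<^bsub>R\<^esub>} \<and> {T. f T \<noteq> \<zero>\<^bsub>R\<^esub>} \<subseteq> Y_inf \<Omega>},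
    mult = bilin_ext R (tree_prod R),
    one = basis_vec R Leaf,
    zero = (\<lambda>T. \<zero>\<^bsub>R\<^esub>),
    add = (\<lambda>f g T. f T \<oplus>\<^bsub>R\<^esub> g T),
    smult = (\<lambda>c f T. c \<otimes>\<^bsub>R\<^esub> f T),
    vee = graft R\<rparr>"

end

theory Submission
  imports Defs
begin

text \<open>
  Both sides of each identity to be shown are multilinear, so everything reduces to basis trees.
  There, the compatibility of grafting with the product is the recursion defining the product, and
  associativity of \<open>T * U * V\<close> follows by a double induction on \<open>T\<close> and \<open>V\<close>: expanding both
  bracketings leaves a common middle term, a left term with \<open>T\<close> replaced by its right subtree, and a
  right term with \<open>V\<close> replaced by its left subtree. A morphism to \<open>A\<close> must send \<open>|\<close> to the unit and
  commute with grafting, which forces its value on every tree; the linear extension of that value is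
  multiplicative because the product of two graftings in \<open>A\<close> obeys the same recursion.
\<close>

section \<open>The algebra of decorated trees\<close>

locale decorated_trees = cring R
  for R :: "('k, 'r) ring_scheme" (structure) and \<Omega> :: "'o set"
begin

abbreviation H :: "('k, 'o tree \<Rightarrow> 'k, 'o) vee_alg" where "H \<equiv> H_LR R \<Omega>"

abbreviation supp :: "('o tree \<Rightarrow> 'k) \<Rightarrow> 'o tree set" where "supp f \<equiv> {T. f T \<noteq> \<zero>}"

lemma Y_inf_iff: "T \<in> Y_inf \<Omega> \<longleftrightarrow> set_tree T \<subseteq> \<Omega>"
  by (auto simp: Y_inf_def Y_def)

lemma H_sel:
  "zero H = (\<lambda>T. \<zero>)" "one H = basis_vec R Leaf"
  "f \<oplus>\<^bsub>H\<^esub> g = (\<lambda>T. f T \<oplus> g T)" "c \<odot>\<^bsub>H\<^esub> f = (\<lambda>T. c \<otimes> f T)"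
  "f \<otimes>\<^bsub>H\<^esub> g = bilin_ext R (tree_prod R) f g" "vee H \<alpha> f g = graft R \<alpha> f g"
  by (simp_all add: H_LR_def)

lemma H_carrier_iff:
  "f \<in> carrier H \<longleftrightarrow> (\<forall>T. f T \<in> carrier R) \<and> finite (supp f) \<and> supp f \<subseteq> Y_inf \<Omega>"
  by (simp add: H_LR_def)

lemma H_carrierD:
  assumes "f \<in> carrier H"
  shows "f T \<in> carrier R" "finite (supp f)" "supp f \<subseteq> Y_inf \<Omega>"
  using assms by (auto simp: H_carrier_iff)

lemma H_carrierI:
  assumes "\<And>T. f T \<in> carrier R" "finite S" "S \<subseteq> Y_inf \<Omega>" "\<And>T. T \<notin> S \<Longrightarrow> f T = \<zero>"
  shows "f \<in> carrier H"
proof -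
  have "supp f \<subseteq> S" using assms(4) by auto
  then show ?thesis using assms(1-3) by (auto simp: H_carrier_iff intro: finite_subset)
qed

lemma basis_vec_closed: "T \<in> Y_inf \<Omega> \<Longrightarrow> basis_vec R T \<in> carrier H"
  by (rule H_carrierI[where S = "{T}"]) (auto simp: basis_vec_def)

lemma H_add_closed: "f \<in> carrier H \<Longrightarrow> g \<in> carrier H \<Longrightarrow> f \<oplus>\<^bsub>H\<^esub> g \<in> carrier H"
  by (rule H_carrierI[where S = "supp f \<union> supp g"]) (auto simp: H_carrier_iff H_sel)

lemma H_smult_closed: "c \<in> carrier R \<Longrightarrow> f \<in> carrier H \<Longrightarrow> c \<odot>\<^bsub>H\<^esub> f \<in> carrier H"
  by (rule H_carrierI[where S = "supp f"]) (auto simp: H_carrier_iff H_sel)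

lemma H_abelian_group: "abelian_group H"
proof (rule abelian_groupI)
  fix f assume f: "f \<in> carrier H"
  have "(\<lambda>T. \<ominus> f T) \<in> carrier H"
    by (rule H_carrierI[where S = "supp f"]) (use f in \<open>auto simp: H_carrier_iff\<close>)
  moreover have "(\<lambda>T. \<ominus> f T) \<oplus>\<^bsub>H\<^esub> f = \<zero>\<^bsub>H\<^esub>"
    using f by (simp add: H_sel H_carrier_iff l_neg)
  ultimately show "\<exists>g\<in>carrier H. g \<oplus>\<^bsub>H\<^esub> f = \<zero>\<^bsub>H\<^esub>" by blast
qed (auto simp: H_add_closed[unfolded H_sel] H_sel H_carrierD a_ac intro: H_carrierI[where S = "{}"])

lemma H_module: "module R H"
  by (rule moduleI)
    (auto simp: H_abelian_group H_smult_closed[unfolded H_sel] is_cring H_sel H_carrierD l_distr r_distr m_assoc)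

sublocale H: module R H
  by (rule H_module)

text \<open>A finitely supported function is a finite linear combination of basis vectors, so a
  property preserved by sums and scalar multiples only has to be checked on those. The multilinear
  identities below are reduced to trees in this way.\<close>

lemma H_induct [consumes 1, case_names basis add smult]:
  assumes f: "f \<in> carrier H"
    and basis: "\<And>T. T \<in> Y_inf \<Omega> \<Longrightarrow> P (basis_vec R T)"
    and add: "\<And>f g. \<lbrakk>f \<in> carrier H; g \<in> carrier H; P f; P g\<rbrakk> \<Longrightarrow> P (f \<oplus>\<^bsub>H\<^esub> g)"
    and smult: "\<And>c f. \<lbrakk>c \<in> carrier R; f \<in> carrier H; P f\<rbrakk> \<Longrightarrow> P (c \<odot>\<^bsub>H\<^esub> f)"
  shows "P f"
proof -
  have "P g" if "finite S" "g \<in> carrier H" "supp g \<subseteq> S" "S \<subseteq> Y_inf \<Omega>" for g S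
    using that
  proof (induction S arbitrary: g)
    case empty
    have leaf: "Leaf \<in> Y_inf \<Omega>" by (simp add: Y_inf_iff)
    \<comment> \<open>The zero element is obtained as the zero multiple of the basis vector of
      \<open>Leaf\<close>, a tree present for every \<Omega>.\<close>
    have "P (\<zero> \<odot>\<^bsub>H\<^esub> basis_vec R Leaf)"
      by (intro smult basis basis_vec_closed leaf zero_closed)
    moreover have "\<zero> \<odot>\<^bsub>H\<^esub> basis_vec R Leaf = g"
      using empty by (auto simp: H_sel basis_vec_def)
    ultimately show ?case by simp
  next
    case (insert T S)
    \<comment> \<open>Clearing the coefficient at \<open>T\<close> moves the support into
      \<open>S\<close>; the part removed is a multiple of the basis vector of
      \<open>T\<close>.\<close>
    let ?g = "g(T := \<zero>)"
    have T: "T \<in> Y_inf \<Omega>" using insert.prems by simp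
    have gT: "g U \<in> carrier R" for U using insert.prems(1) by (rule H_carrierD(1))
    have S: "?g U = \<zero>" if "U \<notin> S" for U using insert.prems that by auto
    have g: "?g \<in> carrier H"
      by (rule H_carrierI[where S = S]) (use insert gT S in auto)
    moreover have "P ?g"
      using insert.prems S by (intro insert.IH g) auto
    moreover have "g T \<odot>\<^bsub>H\<^esub> basis_vec R T \<in> carrier H" "P (g T \<odot>\<^bsub>H\<^esub> basis_vec R T)"
      by (intro smult basis H_smult_closed basis_vec_closed T gT)+
    ultimately have "P (?g \<oplus>\<^bsub>H\<^esub> (g T \<odot>\<^bsub>H\<^esub> basis_vec R T))" by (intro add)
    moreover have "?g \<oplus>\<^bsub>H\<^esub> (g T \<odot>\<^bsub>H\<^esub> basis_vec R T) = g"
      using gT by (auto simp: H_sel basis_vec_def)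
    ultimately show ?case by simp
  qed
  then show ?thesis using H_carrierD[OF f] f by blast
qed

section \<open>Bilinear extension of a map prescribed on pairs of trees\<close>

context
  fixes m :: "'o tree \<Rightarrow> 'o tree \<Rightarrow> 'o tree \<Rightarrow> 'k"
  assumes m: "\<And>T T'. \<lbrakk>T \<in> Y_inf \<Omega>; T' \<in> Y_inf \<Omega>\<rbrakk> \<Longrightarrow> m T T' \<in> carrier H"
begin

lemma m_apply_closed: "T \<in> Y_inf \<Omega> \<Longrightarrow> T' \<in> Y_inf \<Omega> \<Longrightarrow> m T T' U \<in> carrier R"
  using m by (rule H_carrierD(1))

text \<open>Indices outside the supports contribute zero terms. Enlarging the index set lets sums
  for arguments with different supports be compared term by term.\<close>

lemma bilin_ext_superset:
  assumes "f \<in> carrier H" "g \<in> carrier H" "finite S" "finite S'"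
    "supp f \<subseteq> S" "supp g \<subseteq> S'" "S \<subseteq> Y_inf \<Omega>" "S' \<subseteq> Y_inf \<Omega>"
  shows "bilin_ext R m f g U = (\<Oplus>p \<in> S \<times> S'. case p of (T, T') \<Rightarrow> f T \<otimes> g T' \<otimes> m T T' U)"
  unfolding bilin_ext_def
proof (rule add.finprod_mono_neutral_cong_left)
  note D = H_carrierD[OF assms(1)] H_carrierD[OF assms(2)]
  show "supp f \<times> supp g \<subseteq> S \<times> S'" using assms by blast
  show "(case p of (T, T') \<Rightarrow> f T \<otimes> g T' \<otimes> m T T' U) = \<zero>"
    if "p \<in> S \<times> S' - supp f \<times> supp g" for p
  proof -
    obtain T T' where p: "p = (T, T')" "T \<in> Y_inf \<Omega>" "T' \<in> Y_inf \<Omega>" "f T = \<zero> \<or> g T' = \<zero>"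
      using \<open>p \<in> _\<close> assms(7,8) by auto
    have "f T \<in> carrier R" "g T' \<in> carrier R" "m T T' U \<in> carrier R"
      using D p m_apply_closed by blast+
    then show ?thesis using p by auto
  qed
  show "(\<lambda>(T, T'). f T \<otimes> g T' \<otimes> m T T' U) \<in> S \<times> S' \<rightarrow> carrier R"
    using assms(7,8) D(1,4) m_apply_closed by (auto simp: subset_iff)
qed (use assms in auto)

text \<open>Only finitely many pairs of trees contribute, so the support of the value lies in a
  finite union of the finite supports of \<open>m T T'\<close>.\<close>

lemma bilin_ext_closed:
  assumes "f \<in> carrier H" "g \<in> carrier H"
  shows "bilin_ext R m f g \<in> carrier H"
proof (rule H_carrierI[where S = "\<Union>T \<in> supp f. \<Union>T' \<in> supp g. supp (m T T')"])
  note D = H_carrierD[OF assms(1)] H_carrierD[OF assms(2)]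
  have Y: "T \<in> Y_inf \<Omega>" "T' \<in> Y_inf \<Omega>" if "f T \<noteq> \<zero>" "g T' \<noteq> \<zero>" for T T'
    using D that by auto
  show "bilin_ext R m f g U \<in> carrier R" for U
    unfolding bilin_ext_def using D(1,4) Y m_apply_closed by (intro finsum_closed) auto
  show "finite (\<Union>T \<in> supp f. \<Union>T' \<in> supp g. supp (m T T'))"
    using D(2,5) Y H_carrierD(2)[OF m] by (intro finite_UN_I) auto
  show "(\<Union>T \<in> supp f. \<Union>T' \<in> supp g. supp (m T T')) \<subseteq> Y_inf \<Omega>"
    using Y H_carrierD(3)[OF m] by blast
  show "bilin_ext R m f g U = \<zero>" if "U \<notin> (\<Union>T \<in> supp f. \<Union>T' \<in> supp g. supp (m T T'))" for U
    unfolding bilin_ext_def using that D(1,4) by (intro add.finprod_one_eqI) (auto, metis m_closed r_null)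
qed

lemma bilin_ext_basis:
  assumes "T \<in> Y_inf \<Omega>" "T' \<in> Y_inf \<Omega>"
  shows "bilin_ext R m (basis_vec R T) (basis_vec R T') = m T T'"
proof
  fix U
  have "m T T' U \<in> carrier R" using assms by (rule m_apply_closed)
  \<comment> \<open>Singletons as index sets also cover the zero ring, where basis vectors have
    empty support.\<close>
  moreover have "bilin_ext R m (basis_vec R T) (basis_vec R T') U
      = (\<Oplus>p \<in> {T} \<times> {T'}. case p of (V, V') \<Rightarrow> basis_vec R T V \<otimes> basis_vec R T' V' \<otimes> m V V' U)"
    using assms by (intro bilin_ext_superset) (auto simp: basis_vec_closed,
        auto simp: basis_vec_def split: if_splits)
  ultimately show "bilin_ext R m (basis_vec R T) (basis_vec R T') U = m T T' U"
    by (simp add: basis_vec_def)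
qed

lemma bilin_ext_add_left:
  assumes "f \<in> carrier H" "f' \<in> carrier H" "g \<in> carrier H"
  shows "bilin_ext R m (f \<oplus>\<^bsub>H\<^esub> f') g = bilin_ext R m f g \<oplus>\<^bsub>H\<^esub> bilin_ext R m f' g"
proof
  fix U
  \<comment> \<open>Cancellation can make the support of the sum smaller than this union, so all
    three sums are taken over the union.\<close>
  let ?S = "supp f \<union> supp f'" and ?S' = "supp g"
  note D = H_carrierD[OF assms(1)] H_carrierD[OF assms(2)] H_carrierD[OF assms(3)]
  have Y: "m T T' U \<in> carrier R" if "T \<in> ?S" "T' \<in> ?S'" for T T'
    using D(3,6,9) that by (intro m_apply_closed) auto
  have e: "bilin_ext R m h g U = (\<Oplus>p \<in> ?S \<times> ?S'. case p of (T, T') \<Rightarrow> h T \<otimes> g T' \<otimes> m T T' U)"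
    if "h \<in> {f, f', f \<oplus>\<^bsub>H\<^esub> f'}" for h
    using that assms D by (intro bilin_ext_superset) (auto simp: H_add_closed, auto simp: H_sel)
  have "bilin_ext R m (f \<oplus>\<^bsub>H\<^esub> f') g U = (\<Oplus>p \<in> ?S \<times> ?S'.
      (case p of (T, T') \<Rightarrow> f T \<otimes> g T' \<otimes> m T T' U) \<oplus> (case p of (T, T') \<Rightarrow> f' T \<otimes> g T' \<otimes> m T T' U))"
    unfolding e[of "f \<oplus>\<^bsub>H\<^esub> f'", simplified] using D(1,4,7) Y
    by (intro finsum_cong' funcsetI) (auto simp: H_sel l_distr)
  also have "\<dots> = (bilin_ext R m f g \<oplus>\<^bsub>H\<^esub> bilin_ext R m f' g) U"
    using D(1,4,7) Y by (subst finsum_addf) (auto simp: H_sel e)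
  finally show "bilin_ext R m (f \<oplus>\<^bsub>H\<^esub> f') g U = (bilin_ext R m f g \<oplus>\<^bsub>H\<^esub> bilin_ext R m f' g) U" .
qed

lemma bilin_ext_smult_left:
  assumes "c \<in> carrier R" "f \<in> carrier H" "g \<in> carrier H"
  shows "bilin_ext R m (c \<odot>\<^bsub>H\<^esub> f) g = c \<odot>\<^bsub>H\<^esub> bilin_ext R m f g"
proof
  fix U
  let ?S = "supp f" and ?S' = "supp g"
  note D = H_carrierD[OF assms(2)] H_carrierD[OF assms(3)]
  have Y: "m T T' U \<in> carrier R" if "T \<in> ?S" "T' \<in> ?S'" for T T'
    using D(3,6) that by (intro m_apply_closed) auto
  \<comment> \<open>The scalar may annihilate coefficients of \<open>f\<close>, so the sum is taken
    over the support of \<open>f\<close> instead of that of the multiple.\<close>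
  have "bilin_ext R m (c \<odot>\<^bsub>H\<^esub> f) g U =
      (\<Oplus>p \<in> ?S \<times> ?S'. case p of (T, T') \<Rightarrow> (c \<odot>\<^bsub>H\<^esub> f) T \<otimes> g T' \<otimes> m T T' U)"
    using assms D by (intro bilin_ext_superset) (auto simp: H_smult_closed, auto simp: H_sel)
  also have "\<dots> = (\<Oplus>p \<in> ?S \<times> ?S'. c \<otimes> (case p of (T, T') \<Rightarrow> f T \<otimes> g T' \<otimes> m T T' U))"
    using D(1,4) Y assms(1) by (intro finsum_cong' funcsetI) (auto simp: H_sel m_assoc)
  also have "\<dots> = (c \<odot>\<^bsub>H\<^esub> bilin_ext R m f g) U"
    unfolding bilin_ext_def H_sel using D Y assms(1) by (subst finsum_rdistr) auto
  finally show "bilin_ext R m (c \<odot>\<^bsub>H\<^esub> f) g U = (c \<odot>\<^bsub>H\<^esub> bilin_ext R m f g) U" .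
qed

end

text \<open>Commutativity of \<open>R\<close> allows the two coefficients to be exchanged, and the
  index pairs are reindexed by \<open>prod.swap\<close>. This turns linearity in the first argument
  into linearity in the second.\<close>

lemma bilin_ext_swap:
  assumes "f \<in> carrier H" "g \<in> carrier H"
    and m: "\<And>T T'. \<lbrakk>T \<in> Y_inf \<Omega>; T' \<in> Y_inf \<Omega>\<rbrakk> \<Longrightarrow> m T T' \<in> carrier H"
  shows "bilin_ext R m f g = bilin_ext R (\<lambda>T T'. m T' T) g f"
proof
  fix U
  note D = H_carrierD[OF assms(1)] H_carrierD[OF assms(2)]
  have Y: "m T T' U \<in> carrier R" if "T \<in> supp f" "T' \<in> supp g" for T T'
    using D(3,6) that by (intro H_carrierD(1)[OF m]) auto
  have "prod.swap ` (supp g \<times> supp f) = supp f \<times> supp g" by auto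
  moreover have "(\<Oplus>p \<in> prod.swap ` (supp g \<times> supp f). case p of (T, T') \<Rightarrow> f T \<otimes> g T' \<otimes> m T T' U)
      = (\<Oplus>p \<in> supp g \<times> supp f. case prod.swap p of (T, T') \<Rightarrow> f T \<otimes> g T' \<otimes> m T T' U)"
    using D Y by (intro finsum_reindex) auto
  moreover have "\<dots> = (\<Oplus>p \<in> supp g \<times> supp f. case p of (T, T') \<Rightarrow> g T \<otimes> f T' \<otimes> m T' T U)"
    using D(1,4) Y by (intro finsum_cong' funcsetI) (auto simp: m_comm)
  ultimately show "bilin_ext R m f g U = bilin_ext R (\<lambda>T T'. m T' T) g f U"
    by (simp add: bilin_ext_def)
qed

lemma bilin_ext_add_right:
  assumes "\<And>T T'. \<lbrakk>T \<in> Y_inf \<Omega>; T' \<in> Y_inf \<Omega>\<rbrakk> \<Longrightarrow> m T T' \<in> carrier H"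
    and "f \<in> carrier H" "g \<in> carrier H" "g' \<in> carrier H"
  shows "bilin_ext R m f (g \<oplus>\<^bsub>H\<^esub> g') = bilin_ext R m f g \<oplus>\<^bsub>H\<^esub> bilin_ext R m f g'"
  \<comment> \<open>The swap is instantiated at \<open>f\<close>, so it moves \<open>f\<close> to
    the second position and stops there; left additivity then applies.\<close>
  using assms by (simp add: bilin_ext_swap[of f] bilin_ext_add_left H_add_closed)

lemma bilin_ext_smult_right:
  assumes "\<And>T T'. \<lbrakk>T \<in> Y_inf \<Omega>; T' \<in> Y_inf \<Omega>\<rbrakk> \<Longrightarrow> m T T' \<in> carrier H"
    and "c \<in> carrier R" "f \<in> carrier H" "g \<in> carrier H"
  shows "bilin_ext R m f (c \<odot>\<^bsub>H\<^esub> g) = c \<odot>\<^bsub>H\<^esub> bilin_ext R m f g"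
  using assms by (simp add: bilin_ext_swap[of f] bilin_ext_smult_left H_smult_closed)

section \<open>Grafting and the product as bilinear operations on the module\<close>

lemma Node_basis_closed:
  "\<alpha> \<in> \<Omega> \<Longrightarrow> T \<in> Y_inf \<Omega> \<Longrightarrow> T' \<in> Y_inf \<Omega> \<Longrightarrow> basis_vec R (Node T \<alpha> T') \<in> carrier H"
  by (auto simp: Y_inf_iff intro!: basis_vec_closed)

lemma vee_linear:
  assumes "\<alpha> \<in> \<Omega>" "f \<in> carrier H" "g \<in> carrier H"
  shows "vee H \<alpha> f g \<in> carrier H"
    and "f' \<in> carrier H \<Longrightarrow> vee H \<alpha> (f \<oplus>\<^bsub>H\<^esub> f') g = vee H \<alpha> f g \<oplus>\<^bsub>H\<^esub> vee H \<alpha> f' g"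
    and "g' \<in> carrier H \<Longrightarrow> vee H \<alpha> f (g \<oplus>\<^bsub>H\<^esub> g') = vee H \<alpha> f g \<oplus>\<^bsub>H\<^esub> vee H \<alpha> f g'"
    and "c \<in> carrier R \<Longrightarrow> vee H \<alpha> (c \<odot>\<^bsub>H\<^esub> f) g = c \<odot>\<^bsub>H\<^esub> vee H \<alpha> f g"
    and "c \<in> carrier R \<Longrightarrow> vee H \<alpha> f (c \<odot>\<^bsub>H\<^esub> g) = c \<odot>\<^bsub>H\<^esub> vee H \<alpha> f g"
  unfolding H_sel(6) graft_def
  by (intro bilin_ext_closed bilin_ext_add_left bilin_ext_add_right bilin_ext_smult_left
      bilin_ext_smult_right Node_basis_closed assms; assumption)+

lemma vee_basis:
  assumes "\<alpha> \<in> \<Omega>" "T \<in> Y_inf \<Omega>" "T' \<in> Y_inf \<Omega>"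
  shows "vee H \<alpha> (basis_vec R T) (basis_vec R T') = basis_vec R (Node T \<alpha> T')"
  unfolding H_sel(6) graft_def by (intro bilin_ext_basis Node_basis_closed assms)

text \<open>Sequential matching restricts the second defining equation to a \<open>Node\<close> on
  the left; for two leaves the first equation gives the same value.\<close>

lemma tree_prod_Leaf_right: "tree_prod R T Leaf = basis_vec R T"
  by (cases T) simp_all

text \<open>The recursion in terms of the operations of \<open>H\<close>, the form in which their
  closure and compatibility rules apply.\<close>

lemma tree_prod_Node:
  "tree_prod R (Node l \<alpha> r) (Node l' \<beta> r') =
    vee H \<alpha> (basis_vec R l) (tree_prod R r (Node l' \<beta> r')) \<oplus>\<^bsub>H\<^esub>
    vee H \<beta> (tree_prod R (Node l \<alpha> r) l') (basis_vec R r')"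
  by (simp add: H_sel)

lemma Y_inf_Node: "Node l \<alpha> r \<in> Y_inf \<Omega> \<longleftrightarrow> \<alpha> \<in> \<Omega> \<and> l \<in> Y_inf \<Omega> \<and> r \<in> Y_inf \<Omega>"
  by (auto simp: Y_inf_iff)

lemma Y_inf_Leaf: "Leaf \<in> Y_inf \<Omega>"
  by (simp add: Y_inf_iff)

lemma tree_prod_closed:
  "T \<in> Y_inf \<Omega> \<Longrightarrow> T' \<in> Y_inf \<Omega> \<Longrightarrow> tree_prod R T T' \<in> carrier H"
proof (induction T arbitrary: T')
  case Leaf
  then show ?case by (simp add: basis_vec_closed)
next
  case T: (Node l \<alpha> r)
  \<comment> \<open>Each recursive call shrinks one factor only: the outer hypothesis covers the
    right subtree of the first factor against any tree, the inner one the left subtree of the second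
    factor against the unchanged first.\<close>
  from T.prems(2) show ?case
  proof (induction T')
    case Leaf
    then show ?case using T.prems by (simp add: basis_vec_closed)
  next
    case (Node l' \<beta> r')
    then show ?case using T.prems T.IH
      unfolding tree_prod_Node Y_inf_Node
      by (intro H_add_closed vee_linear basis_vec_closed; simp add: Y_inf_Node)
  qed
qed

lemma mult_linear:
  assumes "f \<in> carrier H" "g \<in> carrier H"
  shows "f \<otimes>\<^bsub>H\<^esub> g \<in> carrier H"
    and "f' \<in> carrier H \<Longrightarrow> (f \<oplus>\<^bsub>H\<^esub> f') \<otimes>\<^bsub>H\<^esub> g = f \<otimes>\<^bsub>H\<^esub> g \<oplus>\<^bsub>H\<^esub> f' \<otimes>\<^bsub>H\<^esub> g"
    and "g' \<in> carrier H \<Longrightarrow> f \<otimes>\<^bsub>H\<^esub> (g \<oplus>\<^bsub>H\<^esub> g') = f \<otimes>\<^bsub>H\<^esub> g \<oplus>\<^bsub>H\<^esub> f \<otimes>\<^bsub>H\<^esub> g'"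
    and "c \<in> carrier R \<Longrightarrow> (c \<odot>\<^bsub>H\<^esub> f) \<otimes>\<^bsub>H\<^esub> g = c \<odot>\<^bsub>H\<^esub> (f \<otimes>\<^bsub>H\<^esub> g)"
    and "c \<in> carrier R \<Longrightarrow> f \<otimes>\<^bsub>H\<^esub> (c \<odot>\<^bsub>H\<^esub> g) = c \<odot>\<^bsub>H\<^esub> (f \<otimes>\<^bsub>H\<^esub> g)"
  unfolding H_sel(5)
  by (intro bilin_ext_closed bilin_ext_add_left bilin_ext_add_right bilin_ext_smult_left
      bilin_ext_smult_right tree_prod_closed assms; assumption)+

lemma mult_basis:
  assumes "T \<in> Y_inf \<Omega>" "T' \<in> Y_inf \<Omega>"
  shows "basis_vec R T \<otimes>\<^bsub>H\<^esub> basis_vec R T' = tree_prod R T T'"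
  unfolding H_sel(5) by (intro bilin_ext_basis tree_prod_closed assms)

lemmas H_linear = vee_linear mult_linear H_smult_closed H_add_closed H.smult_r_distr

lemma one_closed: "\<one>\<^bsub>H\<^esub> \<in> carrier H"
  by (simp add: H_sel(2) basis_vec_closed Y_inf_Leaf)

lemma mult_one_left: "f \<in> carrier H \<Longrightarrow> \<one>\<^bsub>H\<^esub> \<otimes>\<^bsub>H\<^esub> f = f"
  by (induction rule: H_induct)
    (simp_all add: H_linear one_closed, simp add: H_sel(2) mult_basis Y_inf_Leaf)

lemma mult_one_right: "f \<in> carrier H \<Longrightarrow> f \<otimes>\<^bsub>H\<^esub> \<one>\<^bsub>H\<^esub> = f"
  by (induction rule: H_induct)
    (simp_all add: H_linear one_closed, simp add: H_sel(2) mult_basis Y_inf_Leaf tree_prod_Leaf_right)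

section \<open>Compatibility of grafting with the product\<close>

lemma vee_mult_basis:
  assumes "\<alpha> \<in> \<Omega>" "\<beta> \<in> \<Omega>" "T \<in> Y_inf \<Omega>" "U \<in> Y_inf \<Omega>" "T' \<in> Y_inf \<Omega>" "U' \<in> Y_inf \<Omega>"
  defines "t \<equiv> basis_vec R T" and "u \<equiv> basis_vec R U"
    and "t' \<equiv> basis_vec R T'" and "u' \<equiv> basis_vec R U'"
  shows "vee H \<alpha> t u \<otimes>\<^bsub>H\<^esub> vee H \<beta> t' u' =
    vee H \<alpha> t (u \<otimes>\<^bsub>H\<^esub> vee H \<beta> t' u') \<oplus>\<^bsub>H\<^esub> vee H \<beta> (vee H \<alpha> t u \<otimes>\<^bsub>H\<^esub> t') u'"
  using assms by (simp add: vee_basis mult_basis Y_inf_Node tree_prod_Node del: tree_prod.simps)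

text \<open>Both sides are linear in each of the four arguments. Starting from trees, the arguments
  are made arbitrary one at a time, in the order \<open>g'\<close>, \<open>f'\<close>,
  \<open>g\<close>, \<open>f\<close>.\<close>

lemma H_vee_mult:
  assumes ab: "\<alpha> \<in> \<Omega>" "\<beta> \<in> \<Omega>" and f: "f \<in> carrier H" and g: "g \<in> carrier H"
    and f': "f' \<in> carrier H" and g': "g' \<in> carrier H"
  shows "vee H \<alpha> f g \<otimes>\<^bsub>H\<^esub> vee H \<beta> f' g' =
    vee H \<alpha> f (g \<otimes>\<^bsub>H\<^esub> vee H \<beta> f' g') \<oplus>\<^bsub>H\<^esub> vee H \<beta> (vee H \<alpha> f g \<otimes>\<^bsub>H\<^esub> f') g'"
proof -
  note lin = ab H_linear basis_vec_closed H.a_ac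
  have b3: "vee H \<alpha> t u \<otimes>\<^bsub>H\<^esub> vee H \<beta> t' g' =
      vee H \<alpha> t (u \<otimes>\<^bsub>H\<^esub> vee H \<beta> t' g') \<oplus>\<^bsub>H\<^esub> vee H \<beta> (vee H \<alpha> t u \<otimes>\<^bsub>H\<^esub> t') g'"
    if "t \<in> basis_vec R ` Y_inf \<Omega>" "u \<in> basis_vec R ` Y_inf \<Omega>" "t' \<in> basis_vec R ` Y_inf \<Omega>" for t u t'
    using g' that by (induction rule: H_induct) (auto simp: lin vee_mult_basis)
  have b2: "vee H \<alpha> t u \<otimes>\<^bsub>H\<^esub> vee H \<beta> f' g' =
      vee H \<alpha> t (u \<otimes>\<^bsub>H\<^esub> vee H \<beta> f' g') \<oplus>\<^bsub>H\<^esub> vee H \<beta> (vee H \<alpha> t u \<otimes>\<^bsub>H\<^esub> f') g'"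
    if "t \<in> basis_vec R ` Y_inf \<Omega>" "u \<in> basis_vec R ` Y_inf \<Omega>" for t u
    using f' b3 that g' by (induction rule: H_induct) (auto simp: lin)
  have b1: "vee H \<alpha> t g \<otimes>\<^bsub>H\<^esub> vee H \<beta> f' g' =
      vee H \<alpha> t (g \<otimes>\<^bsub>H\<^esub> vee H \<beta> f' g') \<oplus>\<^bsub>H\<^esub> vee H \<beta> (vee H \<alpha> t g \<otimes>\<^bsub>H\<^esub> f') g'"
    if "t \<in> basis_vec R ` Y_inf \<Omega>" for t
    using g b2 that f' g' by (induction rule: H_induct) (auto simp: lin)
  show ?thesis
    using f b1 g f' g' by (induction rule: H_induct) (auto simp: lin)
qed

section \<open>Associativity of the product\<close>

lemma mult_assoc_basis:
  assumes "T \<in> Y_inf \<Omega>" "U \<in> Y_inf \<Omega>" "V \<in> Y_inf \<Omega>"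
  shows "(basis_vec R T \<otimes>\<^bsub>H\<^esub> basis_vec R U) \<otimes>\<^bsub>H\<^esub> basis_vec R V =
    basis_vec R T \<otimes>\<^bsub>H\<^esub> (basis_vec R U \<otimes>\<^bsub>H\<^esub> basis_vec R V)"
  using assms
proof (induction T arbitrary: U V)
  case Leaf
  then show ?case by (simp add: H_sel(2)[symmetric] mult_one_left mult_linear(1) basis_vec_closed)
next
  case T: (Node T1 \<alpha> T2)
  from T.prems(3) show ?case
  proof (induction V)
    case Leaf
    show ?case using T.prems
      by (simp add: H_sel(2)[symmetric] mult_one_right mult_linear(1) basis_vec_closed)
  next
    case V: (Node V1 \<gamma> V2)
    show ?case
    proof (cases U)
      case Leaf
      then show ?thesis using T.prems V.prems
        by (simp add: H_sel(2)[symmetric] mult_one_left mult_one_right basis_vec_closed)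
    next
      case U: (Node U1 \<beta> U2)
      have Om: "\<alpha> \<in> \<Omega>" "\<beta> \<in> \<Omega>" "\<gamma> \<in> \<Omega>"
        and Y: "T1 \<in> Y_inf \<Omega>" "T2 \<in> Y_inf \<Omega>" "U1 \<in> Y_inf \<Omega>" "U2 \<in> Y_inf \<Omega>" "V1 \<in> Y_inf \<Omega>" "V2 \<in> Y_inf \<Omega>"
        using T.prems V.prems by (auto simp: U Y_inf_Node)
      define t1 t2 u1 u2 v1 v2 where d: "t1 = basis_vec R T1" "t2 = basis_vec R T2"
        "u1 = basis_vec R U1" "u2 = basis_vec R U2" "v1 = basis_vec R V1" "v2 = basis_vec R V2"
      have cl: "t1 \<in> carrier H" "t2 \<in> carrier H" "u1 \<in> carrier H" "u2 \<in> carrier H"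
        "v1 \<in> carrier H" "v2 \<in> carrier H"
        unfolding d by (intro basis_vec_closed Y)+
      define t u v where e: "t = vee H \<alpha> t1 t2" "u = vee H \<beta> u1 u2" "v = vee H \<gamma> v1 v2"
      have cl': "t \<in> carrier H" "u \<in> carrier H" "v \<in> carrier H"
        unfolding e by (intro vee_linear Om cl)+
      have b: "basis_vec R (Node T1 \<alpha> T2) = t" "basis_vec R U = u" "basis_vec R (Node V1 \<gamma> V2) = v"
        using Y Om by (simp_all add: e d U vee_basis)
      \<comment> \<open>The outer induction passes to the right subtree of \<open>T\<close> with the
        other two trees arbitrary; the inner one passes to the left subtree of \<open>V\<close> with
        \<open>T\<close> and \<open>U\<close> fixed.\<close>
      have IH1: "(t2 \<otimes>\<^bsub>H\<^esub> u) \<otimes>\<^bsub>H\<^esub> v = t2 \<otimes>\<^bsub>H\<^esub> (u \<otimes>\<^bsub>H\<^esub> v)"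
        using T.IH(2)[OF Y(2) T.prems(2) V.prems] by (simp add: b d)
      have IH2: "(t \<otimes>\<^bsub>H\<^esub> u) \<otimes>\<^bsub>H\<^esub> v1 = t \<otimes>\<^bsub>H\<^esub> (u \<otimes>\<^bsub>H\<^esub> v1)"
        using V.IH(1)[OF Y(5)] by (simp add: b d)
      have tu: "t \<otimes>\<^bsub>H\<^esub> u = vee H \<alpha> t1 (t2 \<otimes>\<^bsub>H\<^esub> u) \<oplus>\<^bsub>H\<^esub> vee H \<beta> (t \<otimes>\<^bsub>H\<^esub> u1) u2"
        unfolding e by (intro H_vee_mult Om cl)
      have uv: "u \<otimes>\<^bsub>H\<^esub> v = vee H \<beta> u1 (u2 \<otimes>\<^bsub>H\<^esub> v) \<oplus>\<^bsub>H\<^esub> vee H \<gamma> (u \<otimes>\<^bsub>H\<^esub> v1) v2"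
        unfolding e by (intro H_vee_mult Om cl)
      \<comment> \<open>The products of \<open>t\<close> with \<open>u\<close> and of
        \<open>u\<close> with \<open>v\<close> are sums of graftings whose arguments need not be
        single trees, so compatibility is used for arbitrary \<open>x\<close> and
        \<open>y\<close>.\<close>
      have mv: "vee H \<delta> x y \<otimes>\<^bsub>H\<^esub> v = vee H \<delta> x (y \<otimes>\<^bsub>H\<^esub> v) \<oplus>\<^bsub>H\<^esub> vee H \<gamma> (vee H \<delta> x y \<otimes>\<^bsub>H\<^esub> v1) v2"
        if "\<delta> \<in> \<Omega>" "x \<in> carrier H" "y \<in> carrier H" for \<delta> x y
        unfolding e by (intro H_vee_mult Om cl that)
      have tm: "t \<otimes>\<^bsub>H\<^esub> vee H \<delta> x y = vee H \<alpha> t1 (t2 \<otimes>\<^bsub>H\<^esub> vee H \<delta> x y) \<oplus>\<^bsub>H\<^esub> vee H \<delta> (t \<otimes>\<^bsub>H\<^esub> x) y"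
        if "\<delta> \<in> \<Omega>" "x \<in> carrier H" "y \<in> carrier H" for \<delta> x y
        unfolding e by (intro H_vee_mult Om cl that)
      note lin = Om cl cl' H_linear
      let ?m = "vee H \<beta> (t \<otimes>\<^bsub>H\<^esub> u1) (u2 \<otimes>\<^bsub>H\<^esub> v)"
      \<comment> \<open>Multiplying both summands of \<open>tu\<close> by \<open>v\<close> yields
        two graftings at \<gamma>, which recombine through \<open>tu\<close>, and \<open>?m\<close>
        as the grafting at \<beta>.\<close>
      have L: "(t \<otimes>\<^bsub>H\<^esub> u) \<otimes>\<^bsub>H\<^esub> v =
          vee H \<alpha> t1 ((t2 \<otimes>\<^bsub>H\<^esub> u) \<otimes>\<^bsub>H\<^esub> v) \<oplus>\<^bsub>H\<^esub> ?m \<oplus>\<^bsub>H\<^esub> vee H \<gamma> ((t \<otimes>\<^bsub>H\<^esub> u) \<otimes>\<^bsub>H\<^esub> v1) v2"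
        unfolding tu by (simp add: lin mv H.a_ac)
      \<comment> \<open>Symmetrically, two graftings at \<alpha> recombine through \<open>uv\<close>
        and the same \<open>?m\<close> appears; the outer terms then agree by \<open>IH1\<close> and
        \<open>IH2\<close>.\<close>
      have "t \<otimes>\<^bsub>H\<^esub> (u \<otimes>\<^bsub>H\<^esub> v) =
          vee H \<alpha> t1 (t2 \<otimes>\<^bsub>H\<^esub> (u \<otimes>\<^bsub>H\<^esub> v)) \<oplus>\<^bsub>H\<^esub> ?m \<oplus>\<^bsub>H\<^esub> vee H \<gamma> (t \<otimes>\<^bsub>H\<^esub> (u \<otimes>\<^bsub>H\<^esub> v1)) v2"
        unfolding uv by (simp add: lin tm H.a_ac)
      with L show ?thesis by (simp only: b IH1 IH2)
    qed
  qed
qed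

text \<open>Trilinearity carries the identity over from trees, first in the third factor, then in
  the second, then in the first.\<close>

lemma H_mult_assoc:
  assumes f: "f \<in> carrier H" and g: "g \<in> carrier H" and h: "h \<in> carrier H"
  shows "(f \<otimes>\<^bsub>H\<^esub> g) \<otimes>\<^bsub>H\<^esub> h = f \<otimes>\<^bsub>H\<^esub> (g \<otimes>\<^bsub>H\<^esub> h)"
proof -
  note lin = H_linear basis_vec_closed
  have b2: "(t \<otimes>\<^bsub>H\<^esub> u) \<otimes>\<^bsub>H\<^esub> h = t \<otimes>\<^bsub>H\<^esub> (u \<otimes>\<^bsub>H\<^esub> h)"
    if "t \<in> basis_vec R ` Y_inf \<Omega>" "u \<in> basis_vec R ` Y_inf \<Omega>" for t u
    using h that by (induction rule: H_induct) (auto simp: lin mult_assoc_basis)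
  have b1: "(t \<otimes>\<^bsub>H\<^esub> g) \<otimes>\<^bsub>H\<^esub> h = t \<otimes>\<^bsub>H\<^esub> (g \<otimes>\<^bsub>H\<^esub> h)" if "t \<in> basis_vec R ` Y_inf \<Omega>" for t
    using g b2 that h by (induction rule: H_induct) (auto simp: lin)
  show ?thesis using f b1 g h by (induction rule: H_induct) (auto simp: lin)
qed

lemma H_ring: "ring H"
  by (intro ringI H_abelian_group monoidI)
    (simp_all add: mult_linear one_closed mult_one_left mult_one_right H_mult_assoc)

theorem H_LR_vee_algebra: "vee_algebra R \<Omega> H"
  by (intro vee_algebra.intro assoc_algebra.intro assoc_algebra_axioms.intro
      vee_algebra_axioms.intro H_module H_ring vee_linear mult_linear H_vee_mult)

end

section \<open>The morphism to an arbitrary algebra\<close>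

primrec tree_eval :: "('k, 'a, 'o, 'm) vee_alg_scheme \<Rightarrow> 'o tree \<Rightarrow> 'a" where
  "tree_eval A Leaf = \<one>\<^bsub>A\<^esub>"
| "tree_eval A (Node l \<alpha> r) = vee A \<alpha> (tree_eval A l) (tree_eval A r)"

definition lin_eval ::
  "('k, 'r) ring_scheme \<Rightarrow> ('k, 'a, 'o, 'm) vee_alg_scheme \<Rightarrow> ('o tree \<Rightarrow> 'k) \<Rightarrow> 'a"
  where "lin_eval R A f = (\<Oplus>\<^bsub>A\<^esub>T \<in> {T. f T \<noteq> \<zero>\<^bsub>R\<^esub>}. f T \<odot>\<^bsub>A\<^esub> tree_eval A T)"

context vee_algebra
begin

interpretation T: decorated_trees R \<Omega>
  by unfold_locales

lemma tree_eval_closed: "T \<in> Y_inf \<Omega> \<Longrightarrow> tree_eval A T \<in> carrier A"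
  by (induction T) (auto simp: T.Y_inf_Node vee_closed)

text \<open>Zero coefficients contribute nothing, so evaluations of elements with different supports
  can be written over a common index set.\<close>

lemma lin_eval_superset:
  assumes "f \<in> carrier T.H" "finite S" "T.supp f \<subseteq> S" "S \<subseteq> Y_inf \<Omega>"
  shows "lin_eval R A f = (\<Oplus>\<^bsub>A\<^esub>T \<in> S. f T \<odot>\<^bsub>A\<^esub> tree_eval A T)"
  unfolding lin_eval_def using assms T.H_carrierD[OF assms(1)] tree_eval_closed
  by (intro add.finprod_mono_neutral_cong_left) (auto simp: subset_iff)

lemma lin_eval_closed:
  assumes "f \<in> carrier T.H"
  shows "lin_eval R A f \<in> carrier A"
  unfolding lin_eval_def using T.H_carrierD[OF assms] tree_eval_closed
  by (intro finsum_closed) auto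

lemma lin_eval_basis:
  assumes "T \<in> Y_inf \<Omega>"
  shows "lin_eval R A (basis_vec R T) = tree_eval A T"
proof -
  have "lin_eval R A (basis_vec R T) = (\<Oplus>\<^bsub>A\<^esub>U \<in> {T}. basis_vec R T U \<odot>\<^bsub>A\<^esub> tree_eval A U)"
    using assms
    by (intro lin_eval_superset) (auto simp: T.basis_vec_closed,
        auto simp: basis_vec_def split: if_splits)
  then show ?thesis using assms tree_eval_closed by (simp add: basis_vec_def)
qed

lemma lin_eval_add:
  assumes "f \<in> carrier T.H" "g \<in> carrier T.H"
  shows "lin_eval R A (f \<oplus>\<^bsub>T.H\<^esub> g) = lin_eval R A f \<oplus>\<^bsub>A\<^esub> lin_eval R A g"
proof -
  let ?S = "T.supp f \<union> T.supp g"
  note D = T.H_carrierD[OF assms(1)] T.H_carrierD[OF assms(2)]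
  have Y: "tree_eval A T \<in> carrier A" if "T \<in> ?S" for T
    using D that by (intro tree_eval_closed) auto
  have e: "lin_eval R A h = (\<Oplus>\<^bsub>A\<^esub>T \<in> ?S. h T \<odot>\<^bsub>A\<^esub> tree_eval A T)"
    if "h \<in> {f, g, f \<oplus>\<^bsub>T.H\<^esub> g}" for h
    using that assms D by (intro lin_eval_superset) (auto simp: T.H_add_closed, auto simp: T.H_sel)
  have "lin_eval R A (f \<oplus>\<^bsub>T.H\<^esub> g) =
      (\<Oplus>\<^bsub>A\<^esub>T \<in> ?S. f T \<odot>\<^bsub>A\<^esub> tree_eval A T \<oplus>\<^bsub>A\<^esub> g T \<odot>\<^bsub>A\<^esub> tree_eval A T)"
    unfolding e[of "f \<oplus>\<^bsub>T.H\<^esub> g", simplified] using D(1,4) Y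
    by (intro finsum_cong' funcsetI) (auto simp: T.H_sel smult_l_distr)
  also have "\<dots> = lin_eval R A f \<oplus>\<^bsub>A\<^esub> lin_eval R A g"
    using D(1,4) Y by (subst finsum_addf) (auto simp: e)
  finally show ?thesis .
qed

lemma lin_eval_smult:
  assumes "c \<in> carrier R" "f \<in> carrier T.H"
  shows "lin_eval R A (c \<odot>\<^bsub>T.H\<^esub> f) = c \<odot>\<^bsub>A\<^esub> lin_eval R A f"
proof -
  note D = T.H_carrierD[OF assms(2)]
  have Y: "tree_eval A T \<in> carrier A" if "T \<in> T.supp f" for T
    using D that by (intro tree_eval_closed) auto
  have "lin_eval R A (c \<odot>\<^bsub>T.H\<^esub> f) = (\<Oplus>\<^bsub>A\<^esub>T \<in> T.supp f. (c \<odot>\<^bsub>T.H\<^esub> f) T \<odot>\<^bsub>A\<^esub> tree_eval A T)"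
    using assms D by (intro lin_eval_superset) (auto simp: T.H_smult_closed, auto simp: T.H_sel)
  also have "\<dots> = (\<Oplus>\<^bsub>A\<^esub>T \<in> T.supp f. c \<odot>\<^bsub>A\<^esub> (f T \<odot>\<^bsub>A\<^esub> tree_eval A T))"
    using D(1) Y assms(1) by (intro finsum_cong' funcsetI) (auto simp: T.H_sel smult_assoc1)
  also have "\<dots> = c \<odot>\<^bsub>A\<^esub> lin_eval R A f"
    unfolding lin_eval_def using D Y assms(1) by (subst finsum_smult_ldistr) auto
  finally show ?thesis .
qed

lemmas lin_eval_linear = lin_eval_closed lin_eval_add lin_eval_smult

section \<open>Evaluation respects grafting and product\<close>

lemma lin_eval_vee:
  assumes al: "\<alpha> \<in> \<Omega>" and f: "f \<in> carrier T.H" and g: "g \<in> carrier T.H"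
  shows "lin_eval R A (vee T.H \<alpha> f g) = vee A \<alpha> (lin_eval R A f) (lin_eval R A g)"
proof -
  note lin = al T.H_linear T.basis_vec_closed lin_eval_linear tree_eval_closed
    vee_add_left vee_add_right vee_smult_left vee_smult_right
  \<comment> \<open>With \<open>f\<close> a tree, linearity in \<open>g\<close> leaves a pair of
    trees, where the claim is the recursion of \<open>tree_eval\<close>.\<close>
  have b: "lin_eval R A (vee T.H \<alpha> (basis_vec R T) g) = vee A \<alpha> (lin_eval R A (basis_vec R T)) (lin_eval R A g)"
    if "T \<in> Y_inf \<Omega>" for T
    using g by (induction rule: T.H_induct)
      (use that al in \<open>simp_all add: lin T.vee_basis lin_eval_basis T.Y_inf_Node\<close>)
  show ?thesis
    using f b g by (induction rule: T.H_induct) (simp_all add: lin)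
qed

text \<open>Evaluation turns the recursion for the product of two trees into the axiom
  \<open>vee_mult\<close> of \<open>A\<close>; the double induction follows that recursion.\<close>

lemma lin_eval_tree_prod:
  "T \<in> Y_inf \<Omega> \<Longrightarrow> U \<in> Y_inf \<Omega> \<Longrightarrow>
    lin_eval R A (tree_prod R T U) = tree_eval A T \<otimes>\<^bsub>A\<^esub> tree_eval A U"
proof (induction T arbitrary: U)
  case Leaf
  then show ?case by (simp add: lin_eval_basis tree_eval_closed)
next
  case T: (Node l \<alpha> r)
  from T.prems(2) show ?case
  proof (induction U)
    case Leaf
    then show ?case using T.prems tree_eval_closed[OF T.prems(1)] by (simp add: lin_eval_basis)
  next
    case U: (Node l' \<beta> r')
    have Y: "\<alpha> \<in> \<Omega>" "\<beta> \<in> \<Omega>" "l \<in> Y_inf \<Omega>" "r \<in> Y_inf \<Omega>" "l' \<in> Y_inf \<Omega>" "r' \<in> Y_inf \<Omega>"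
      using T.prems(1) U.prems by (auto simp: T.Y_inf_Node)
    note cl = T.prems(1) U.prems Y T.tree_prod_closed T.basis_vec_closed T.vee_linear(1)
    \<comment> \<open>The inner hypothesis evaluates the product with the left subtree
      \<open>l'\<close>, the outer one the product of \<open>r\<close> with the whole second tree;
      these are the two products occurring on the right of \<open>vee_mult\<close>.\<close>
    show ?case
      using U.IH(1) T.IH(2)[of "Node l' \<beta> r'"] Y
      by (simp add: T.tree_prod_Node cl lin_eval_add lin_eval_vee lin_eval_basis vee_mult
          tree_eval_closed del: tree_prod.simps)
  qed
qed

lemma lin_eval_mult:
  assumes f: "f \<in> carrier T.H" and g: "g \<in> carrier T.H"
  shows "lin_eval R A (f \<otimes>\<^bsub>T.H\<^esub> g) = lin_eval R A f \<otimes>\<^bsub>A\<^esub> lin_eval R A g"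
proof -
  note lin = T.H_linear T.basis_vec_closed lin_eval_linear tree_eval_closed l_distr r_distr
    smult_mult_left smult_mult_right
  have b: "lin_eval R A (basis_vec R T \<otimes>\<^bsub>T.H\<^esub> g) = lin_eval R A (basis_vec R T) \<otimes>\<^bsub>A\<^esub> lin_eval R A g"
    if "T \<in> Y_inf \<Omega>" for T
    using g by (induction rule: T.H_induct)
      (use that in \<open>simp_all add: lin T.mult_basis lin_eval_basis lin_eval_tree_prod\<close>)
  show ?thesis
    using f b g by (induction rule: T.H_induct) (simp_all add: lin)
qed

section \<open>Existence and uniqueness of the morphism\<close>

lemma lin_eval_hom: "restrict (lin_eval R A) (carrier T.H) \<in> vee_hom R \<Omega> T.H A"
proof -
  have "lin_eval R A \<one>\<^bsub>T.H\<^esub> = \<one>\<^bsub>A\<^esub>"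
    by (simp add: T.H_sel(2) lin_eval_basis T.Y_inf_Leaf)
  \<comment> \<open>The carrier is closed under all operations, so restricting to it does not alter
    the values in the morphism equations.\<close>
  then show ?thesis
    by (auto simp: vee_hom_def ring_hom_def T.H_linear T.one_closed lin_eval_linear lin_eval_mult
        lin_eval_vee)
qed

text \<open>The unit and grafting conditions determine a morphism on every tree by induction, and
  linearity then determines it on the carrier. \<open>vee_hom\<close> constrains nothing outside the
  carrier, so agreement is asserted only there.\<close>

lemma vee_hom_eq_lin_eval:
  assumes \<psi>: "\<psi> \<in> vee_hom R \<Omega> T.H A" and f: "f \<in> carrier T.H"
  shows "\<psi> f = lin_eval R A f"
proof -
  have hom: "\<psi> \<one>\<^bsub>T.H\<^esub> = \<one>\<^bsub>A\<^esub>"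
    "x \<in> carrier T.H \<Longrightarrow> y \<in> carrier T.H \<Longrightarrow> \<psi> (x \<oplus>\<^bsub>T.H\<^esub> y) = \<psi> x \<oplus>\<^bsub>A\<^esub> \<psi> y"
    "c \<in> carrier R \<Longrightarrow> x \<in> carrier T.H \<Longrightarrow> \<psi> (c \<odot>\<^bsub>T.H\<^esub> x) = c \<odot>\<^bsub>A\<^esub> \<psi> x"
    "\<alpha> \<in> \<Omega> \<Longrightarrow> x \<in> carrier T.H \<Longrightarrow> y \<in> carrier T.H \<Longrightarrow> \<psi> (vee T.H \<alpha> x y) = vee A \<alpha> (\<psi> x) (\<psi> y)"
    for x y c \<alpha>
    using \<psi> by (auto simp: vee_hom_def ring_hom_def)
  have "\<psi> (basis_vec R T) = tree_eval A T" if "T \<in> Y_inf \<Omega>" for T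
    using that
  proof (induction T)
    case Leaf
    show ?case using hom(1) by (simp add: T.H_sel(2))
  next
    case (Node l \<alpha> r)
    then show ?case
      \<comment> \<open>The basis vector of a \<open>Node\<close> is read as a grafting of basis
        vectors, to which the morphism condition applies.\<close>
      by (simp add: T.Y_inf_Node hom(4) T.basis_vec_closed flip: T.vee_basis)
  qed
  with f show ?thesis
    by (induction rule: T.H_induct) (simp_all add: lin_eval_basis hom lin_eval_linear)
qed

lemma ex1_vee_hom:
  "\<exists>!\<phi>. \<phi> \<in> vee_hom R \<Omega> (H_LR R \<Omega>) A \<and> \<phi> \<in> extensional (carrier (H_LR R \<Omega>))"
proof (rule ex1I)
  show "restrict (lin_eval R A) (carrier T.H) \<in> vee_hom R \<Omega> T.H A \<and>
      restrict (lin_eval R A) (carrier T.H) \<in> extensional (carrier T.H)"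
    using lin_eval_hom by simp
  show "\<phi> = restrict (lin_eval R A) (carrier T.H)"
    if "\<phi> \<in> vee_hom R \<Omega> T.H A \<and> \<phi> \<in> extensional (carrier T.H)" for \<phi>
    \<comment> \<open>Extensionality turns agreement on the carrier into equality of
      functions.\<close>
    using that by (intro extensionalityI[of _ "carrier T.H"]) (auto simp: vee_hom_eq_lin_eval)
qed

end

theorem theorem3p5:
  fixes R :: "('k, 'r) ring_scheme" and \<Omega> :: "'o set" and j :: "'x \<Rightarrow> 'o tree \<Rightarrow> 'k"
  assumes "cring R" and "\<Omega> \<noteq> {}"
  shows "free_vee_algebra TYPE('a) R \<Omega> {} j (H_LR R \<Omega>) \<and>
    vee_algebra R \<Omega> (H_LR R \<Omega>) \<and>
    (\<forall>A :: ('k, 'a, 'o) vee_alg. vee_algebra R \<Omega> A \<longrightarrow>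
      (\<exists>!\<phi>. \<phi> \<in> vee_hom R \<Omega> (H_LR R \<Omega>) A \<and> \<phi> \<in> extensional (carrier (H_LR R \<Omega>))))"
proof -
  have "decorated_trees R" using assms(1) by (simp add: decorated_trees_def)
  \<comment> \<open>On the empty set the conditions on \<open>j\<close> and on the prescribed map
    are vacuous, so freeness reduces to the unique existence of a morphism.\<close>
  then show ?thesis
    by (simp add: free_vee_algebra_def decorated_trees.H_LR_vee_algebra vee_algebra.ex1_vee_hom)
qed

end
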